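(* Let $\mathscr{A}$ be a complex Banach algebra with unit $1$. Let $a,\delta a\in\mathscr{A}$ and let $p,q\in\mathscr{A}$ be idempotents such that $a^{(2,l)}_{p,q}$ exists. Put $\bar a=a+\delta a$. Then the following statements are equivalent: (1) $1+\delta a\,a^{(2,l)}_{p,q}$ is invertible; (2) $1+a^{(2,l)}_{p,q}\,\delta a$ is invertible; (3) $\bar a^{(2,l)}_{p,q}$ exists. In this case, $\bar a^{(2,l)}_{p,q}=a^{(2,l)}_{p,q}(1+\delta a\,a^{(2,l)}_{p,q})^{-1}=(1+a^{(2,l)}_{p,q}\,\delta a)^{-1}a^{(2,l)}_{p,q}$.
   Context: For $x\in\mathscr{A}$ let $R_r(x)=\{xy: y\in\mathscr{A}\}$ and $K_r(x)=\{y\in\mathscr{A}: xy=0\}$. For $a\in\mathscr{A}$ and idempotents $p,q\in\mathscr{A}$, the $(p,q,l)$-outer generalized inverse $a^{(2,l)}_{p,q}$ is an element $b\in\mathscr{A}$ with $bab=b$, $R_r(b)=R_r(p)$, $K_r(b)=R_r(q)$; it is unique if it exists. *)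

theory Defs
  imports Complex_Main
begin

(* The library only has real Banach algebras.  Here a compatible complex scalar
   multiplication is added.  The norm is submultiplicative (real_normed_algebra);
   neither norm 1 = 1 nor 1 \<noteq> 0 is required. *)
class complex_banach_algebra_1 = real_normed_algebra + banach + monoid_mult +
  fixes scaleC :: "complex \<Rightarrow> 'a \<Rightarrow> 'a" (infixr "*\<^sub>C" 75)
  assumes scaleC_add_right: "c *\<^sub>C (x + y) = c *\<^sub>C x + c *\<^sub>C y"
    and scaleC_add_left: "(c + d) *\<^sub>C x = c *\<^sub>C x + d *\<^sub>C x"
    and scaleC_scaleC: "c *\<^sub>C d *\<^sub>C x = (c * d) *\<^sub>C x"
    and scaleC_one: "1 *\<^sub>C x = x"
    and scaleR_scaleC: "r *\<^sub>R x = complex_of_real r *\<^sub>C x"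
    and mult_scaleC_left: "(c *\<^sub>C x) * y = c *\<^sub>C (x * y)"
    and mult_scaleC_right: "x * (c *\<^sub>C y) = c *\<^sub>C (x * y)"
    and norm_scaleC: "norm (c *\<^sub>C x) = cmod c * norm x"

instantiation complex :: complex_banach_algebra_1
begin

definition scaleC_complex :: "complex \<Rightarrow> complex \<Rightarrow> complex" where
  "scaleC_complex c x = c * x"

instance
  by standard (simp_all add: scaleC_complex_def algebra_simps norm_mult scaleR_conv_of_real)

end

definition ring_invertible :: "'a::{ring, monoid_mult} \<Rightarrow> bool" where
  "ring_invertible x \<longleftrightarrow> (\<exists>y. x * y = 1 \<and> y * x = 1)"

(* Meaningful only for invertible elements, like outer_inv below
   when has_outer_inv holds. *)
definition ring_inverse :: "'a::{ring, monoid_mult} \<Rightarrow> 'a" where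
  "ring_inverse x = (THE y. x * y = 1 \<and> y * x = 1)"

definition right_range :: "'a::ring \<Rightarrow> 'a set" where
  "right_range x = {x * y | y. True}"

definition right_kernel :: "'a::ring \<Rightarrow> 'a set" where
  "right_kernel x = {y. x * y = 0}"

(* The condition on the kernel of b involves the range, not the kernel, of q. *)
definition is_outer_inv :: "'a::ring \<Rightarrow> 'a \<Rightarrow> 'a \<Rightarrow> 'a \<Rightarrow> bool" where
  "is_outer_inv a p q b \<longleftrightarrow>
     b * a * b = b \<and> right_range b = right_range p \<and> right_kernel b = right_range q"

definition has_outer_inv :: "'a::ring \<Rightarrow> 'a \<Rightarrow> 'a \<Rightarrow> bool" where
  "has_outer_inv a p q \<longleftrightarrow> (\<exists>b. is_outer_inv a p q b)"

definition outer_inv :: "'a::ring \<Rightarrow> 'a \<Rightarrow> 'a \<Rightarrow> 'a" where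
  "outer_inv a p q = (THE b. is_outer_inv a p q b)"

lemma ring_inverse_eq:
  assumes "x * y = 1" "y * x = 1"
  shows "ring_inverse x = y"
  unfolding ring_inverse_def
proof (rule the_equality)
  fix z assume "x * z = 1 \<and> z * x = 1"
  then have "z = (y * x) * z" "x * z = 1" using assms by simp_all
  then show "z = y" by (simp add: mult.assoc)
qed (use assms in simp)

lemma is_outer_inv_unique:
  fixes a p q b c :: "'a::{ring, monoid_mult}"
  assumes "is_outer_inv a p q b" "is_outer_inv a p q c"
  shows "b = c"
proof -
  have b: "b * a * b = b" and c: "c * a * c = c"
    and R: "right_range b = right_range c" and K: "right_kernel b = right_kernel c"
    using assms by (auto simp: is_outer_inv_def)
  have "b * 1 \<in> right_range b" unfolding right_range_def by blast
  then have "b \<in> right_range c" by (simp add: R)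
  then obtain y where y: "b = c * y" by (auto simp: right_range_def)
  have 1: "c * a * b = b" using c by (simp add: y mult.assoc[symmetric])
  have "1 - a * b \<in> right_kernel b"
    using b by (simp add: right_kernel_def right_diff_distrib mult.assoc)
  then have "1 - a * b \<in> right_kernel c" by (simp add: K)
  then have "c * (1 - a * b) = 0" by (simp add: right_kernel_def)
  then have "c * a * b = c" by (simp add: right_diff_distrib mult.assoc)
  with 1 show ?thesis by simp
qed

lemma outer_inv_eq:
  fixes a p q b :: "'a::{ring, monoid_mult}"
  assumes "is_outer_inv a p q b"
  shows "outer_inv a p q = b"
  unfolding outer_inv_def using assms is_outer_inv_unique by blast

end

theory Submission
  imports Defs
begin

text \<open>
  Let \<open>b\<close> be the outer inverse of \<open>a\<close> and write \<open>d\<close> for the perturbation.  If \<open>1 + d b\<close> is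
  invertible, then so is \<open>1 + b d\<close>, and \<open>c = b (1 + d b)\<^sup>-\<^sup>1 = (1 + b d)\<^sup>-\<^sup>1 b\<close> has the range and the
  kernel of \<open>b\<close>, while \<open>b (a + d) b = b (1 + d b)\<close> gives \<open>c (a + d) c = c\<close>.  Conversely, let \<open>c\<close> be
  an outer inverse of \<open>a + d\<close>.  Equality of ranges and kernels yields \<open>b = b (a + d) c = c + b d c\<close>
  and \<open>b = c (a + d) b = c + c d b\<close>, so that \<open>1 - c d\<close> is a two-sided inverse of \<open>1 + b d\<close>.
\<close>

text \<open>Jacobson's lemma. The formal series \<open>1 - y * x + y * x * y * x - ...\<close>
  regroups as \<open>1 - y * z * x\<close>, where \<open>z\<close> stands for the series of the
  inverse of \<open>1 + x * y\<close>; this suggests the formula, which is then checked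
  algebraically.\<close>

lemma inverse_one_add_swap:
  fixes x y z :: "'a::{ring, monoid_mult}"
  assumes "(1 + x * y) * z = 1" "z * (1 + x * y) = 1"
  shows "(1 + y * x) * (1 - y * z * x) = 1" "(1 - y * z * x) * (1 + y * x) = 1"
proof -
  have "(1 + y * x) * (1 - y * z * x) = 1 + y * x - y * ((1 + x * y) * z) * x"
    by (simp add: algebra_simps)
  then show "(1 + y * x) * (1 - y * z * x) = 1" by (simp add: assms)
  have "(1 - y * z * x) * (1 + y * x) = 1 + y * x - y * (z * (1 + x * y)) * x"
    by (simp add: algebra_simps)
  then show "(1 - y * z * x) * (1 + y * x) = 1" by (simp add: assms)
qed

lemma ring_invertible_one_add_swap:
  fixes x y :: "'a::{ring, monoid_mult}"
  shows "ring_invertible (1 + x * y) \<longleftrightarrow> ring_invertible (1 + y * x)"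
  unfolding ring_invertible_def by (meson inverse_one_add_swap)

lemma ring_inverse:
  fixes x :: "'a::{ring, monoid_mult}"
  assumes "ring_invertible x"
  shows "x * ring_inverse x = 1" "ring_inverse x * x = 1"
  using assms by (auto simp: ring_invertible_def ring_inverse_eq)

text \<open>A right inverse of \<open>u\<close> suffices: \<open>b = b * u * w\<close> puts each
  multiple of \<open>b\<close> into the range of \<open>b * u\<close>.\<close>

lemma right_range_mult_unit:
  fixes b u w :: "'a::{ring, monoid_mult}"
  assumes "u * w = 1"
  shows "right_range (b * u) = right_range b"
proof -
  have "b * y = b * u * (w * y)" for y
    by (metis assms mult.assoc mult.left_neutral)
  then show ?thesis
    unfolding right_range_def by (metis (no_types, opaque_lifting) mult.assoc)
qed

text \<open>A left inverse makes \<open>v\<close> left cancellable, so multiplying by it on the left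
  creates no new annihilated elements.\<close>

lemma right_kernel_unit_mult:
  fixes b v w :: "'a::{ring, monoid_mult}"
  assumes "w * v = 1"
  shows "right_kernel (v * b) = right_kernel b"
proof -
  have "b * y = w * (v * (b * y))" for y
    by (simp add: assms flip: mult.assoc)
  then have "v * (b * y) = 0 \<longleftrightarrow> b * y = 0" for y
    by (metis mult_zero_right)
  then show ?thesis
    by (simp add: right_kernel_def mult.assoc)
qed

text \<open>This comes from \<open>b * (1 + d * b) = (1 + b * d) * b\<close> by cancelling one
  factor on each side.\<close>

lemma inverse_one_add_intertwine:
  fixes b d u v :: "'a::{ring, monoid_mult}"
  assumes "(1 + d * b) * u = 1" "v * (1 + b * d) = 1"
  shows "b * u = v * b"
proof -
  have "b * u = v * (1 + b * d) * (b * u)" by (simp add: assms)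
  also have "\<dots> = v * b * ((1 + d * b) * u)" by (simp add: algebra_simps)
  finally show ?thesis by (simp add: assms)
qed

lemma is_outer_inv_perturbed:
  fixes a b d p q u v :: "'a::{ring, monoid_mult}"
  assumes b: "is_outer_inv a p q b"
    and u: "(1 + d * b) * u = 1" "u * (1 + d * b) = 1"
    and v: "(1 + b * d) * v = 1" "v * (1 + b * d) = 1"
  shows "is_outer_inv (a + d) p q (b * u)"
proof -
  have bab: "b * a * b = b" using b by (simp add: is_outer_inv_def)
  have bu: "b * u = v * b" using u(1) v(2) by (rule inverse_one_add_intertwine)
  \<comment> \<open>Only the left factor changes form, which moves both units to the outside and
    leaves \<open>b * (a + d) * b\<close> in the middle.\<close>
  have "b * u * (a + d) * (b * u) = v * b * (a + d) * (b * u)" by (simp only: bu)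
  also have "\<dots> = v * (b * a * b + b * d * b) * u" by (simp add: algebra_simps)
  also have "\<dots> = v * b * ((1 + d * b) * u)"
    unfolding bab by (simp add: algebra_simps)
  also have "\<dots> = b * u" by (simp add: u bu)
  finally have "b * u * (a + d) * (b * u) = b * u" .
  \<comment> \<open>The form \<open>b * u\<close> settles the range, the form \<open>v * b\<close>
    the kernel.\<close>
  moreover have "right_range (b * u) = right_range b" using u(2) by (rule right_range_mult_unit)
  moreover have "right_kernel (b * u) = right_kernel b"
    unfolding bu using v(1) by (rule right_kernel_unit_mult)
  ultimately show ?thesis using b by (simp add: is_outer_inv_def)
qed

text \<open>Left multiplication by \<open>c * a'\<close> fixes the range of \<open>c\<close>, which
  contains \<open>b\<close>; and \<open>1 - a' * c\<close> lies in the kernel of \<open>c\<close>,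
  hence in that of \<open>b\<close>.\<close>

lemma is_outer_inv_absorb:
  fixes a a' b c p q :: "'a::{ring, monoid_mult}"
  assumes b: "is_outer_inv a p q b" and c: "is_outer_inv a' p q c"
  shows "c * a' * b = b" "b * a' * c = b"
proof -
  have cac: "c * a' * c = c" and R: "right_range b = right_range c"
    and K: "right_kernel b = right_kernel c"
    using b c by (auto simp: is_outer_inv_def)
  have "b * 1 \<in> right_range b" unfolding right_range_def by blast
  then have "b \<in> right_range c" by (simp add: R)
  then obtain y where y: "b = c * y" by (auto simp: right_range_def)
  show "c * a' * b = b" using cac by (simp add: y flip: mult.assoc)
  have "1 - a' * c \<in> right_kernel c"
    using cac by (simp add: right_kernel_def right_diff_distrib mult.assoc)
  then have "1 - a' * c \<in> right_kernel b" by (simp add: K)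
  then show "b * a' * c = b" by (simp add: right_kernel_def right_diff_distrib mult.assoc)
qed

lemma ring_invertible_if_perturbed_outer_inv:
  fixes a b c d p q :: "'a::{ring, monoid_mult}"
  assumes b: "is_outer_inv a p q b" and c: "is_outer_inv (a + d) p q c"
  shows "ring_invertible (1 + b * d)"
proof -
  \<comment> \<open>Absorption is used in both directions: \<open>b * (a + d) * c = b\<close>, and
    with the roles exchanged \<open>b * a * c = c\<close>.\<close>
  have 1: "b = c + b * d * c"
    using is_outer_inv_absorb(2)[OF b c] is_outer_inv_absorb(1)[OF c b]
    by (simp add: distrib_left distrib_right)
  have 2: "b = c + c * d * b"
    using is_outer_inv_absorb(1)[OF b c] is_outer_inv_absorb(2)[OF c b]
    by (simp add: distrib_left distrib_right)
  \<comment> \<open>The candidate \<open>1 - c * d\<close> is Jacobson's formula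
    \<open>1 - b * u * d\<close> with the expected value \<open>c = b * u\<close>.\<close>
  have "(1 + b * d) * (1 - c * d) = 1 + (b - (c + b * d * c)) * d"
    by (simp add: algebra_simps)
  moreover have "(1 - c * d) * (1 + b * d) = 1 + (b - (c + c * d * b)) * d"
    by (simp add: algebra_simps)
  ultimately show ?thesis
    unfolding ring_invertible_def using 1 2 by (metis add_0_right diff_self mult_zero_left)
qed

theorem theorem3p4:
  fixes a \<delta>a p q :: "'a::complex_banach_algebra_1"
  assumes "p * p = p" and "q * q = q"
    and "has_outer_inv a p q"
  shows "(ring_invertible (1 + \<delta>a * outer_inv a p q) \<longleftrightarrow>
            ring_invertible (1 + outer_inv a p q * \<delta>a)) \<and>
         (ring_invertible (1 + outer_inv a p q * \<delta>a) \<longleftrightarrow>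
            has_outer_inv (a + \<delta>a) p q) \<and>
         (has_outer_inv (a + \<delta>a) p q \<longrightarrow>
            outer_inv (a + \<delta>a) p q =
              outer_inv a p q * ring_inverse (1 + \<delta>a * outer_inv a p q) \<and>
            outer_inv (a + \<delta>a) p q =
              ring_inverse (1 + outer_inv a p q * \<delta>a) * outer_inv a p q)"
proof -
  define b where "b = outer_inv a p q"
  have b: "is_outer_inv a p q b"
    using assms(3) unfolding b_def has_outer_inv_def by (metis outer_inv_eq)
  let ?u = "ring_inverse (1 + \<delta>a * b)" and ?v = "ring_inverse (1 + b * \<delta>a)"
  have swap: "ring_invertible (1 + \<delta>a * b) \<longleftrightarrow> ring_invertible (1 + b * \<delta>a)"
    by (rule ring_invertible_one_add_swap)
  have conv: "ring_invertible (1 + b * \<delta>a)" if "has_outer_inv (a + \<delta>a) p q"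
    using that ring_invertible_if_perturbed_outer_inv[OF b] by (auto simp: has_outer_inv_def)
  have formula: "is_outer_inv (a + \<delta>a) p q (b * ?u)" "b * ?u = ?v * b"
    if v: "ring_invertible (1 + b * \<delta>a)"
  proof -
    have u: "ring_invertible (1 + \<delta>a * b)" using v swap by simp
    show "is_outer_inv (a + \<delta>a) p q (b * ?u)"
      using b ring_inverse[OF u] ring_inverse[OF v] by (rule is_outer_inv_perturbed)
    show "b * ?u = ?v * b"
      using ring_inverse(1)[OF u] ring_inverse(2)[OF v] by (rule inverse_one_add_intertwine)
  qed
  have "ring_invertible (1 + b * \<delta>a) \<longleftrightarrow> has_outer_inv (a + \<delta>a) p q"
    using conv formula(1) unfolding has_outer_inv_def by blast
  moreover have "outer_inv (a + \<delta>a) p q = b * ?u \<and> outer_inv (a + \<delta>a) p q = ?v * b"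
    if "has_outer_inv (a + \<delta>a) p q"
    using formula[OF conv[OF that]] outer_inv_eq by metis
  ultimately show ?thesis
    using swap unfolding b_def by blast
qed

end
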